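(* Let $q$ be a power of a prime $p$, $s\ge1$, and let $N>1$ be an integer with $N-1\mid q^s-1$ and $p\mid N$. Let $\Delta\subset\{0,1,\dots,N-1\}$ with $0\in\Delta$ and let $d=d(\Delta)=\max\Delta$. The dimension over $\mathbb{F}_q$ of $(\mathrm{PRS}(N,\Delta)_q)^\perp$ is $$\dim(\mathrm{PRS}(N,\Delta)_q)^\perp=\begin{cases}\displaystyle\sum_{a\in\mathcal{A},\ \mathfrak{I}_a\cap\Delta^\perp\ne\emptyset}n_a+n_d&\text{if }\mathfrak{I}_d\subset\Delta,\\[2ex]\displaystyle\sum_{a\in\mathcal{A},\ \mathfrak{I}_a\cap\Delta^\perp\ne\emptyset}n_a+1&\text{if }\mathfrak{I}_d\not\subset\Delta.\end{cases}$$
   Context: Points and codes. $Y_N=\{z\in\mathbb{F}_{q^s}: z^N=z\}$, $X_N=\{(1,z): z\in Y_N\}\cup\{(0,1)\}\subset \mathbb{F}_{q^s}^2$, $\mathrm{ev}_{X_N}(f)=(f(P))_{P\in X_N}\in\mathbb{F}_{q^s}^{N+1}$ for $f\in\mathbb{F}_{q^s}[x_0,x_1]$ (with $0^0=1$). $\mathrm{PRS}(N,\Delta)$ is the $\mathbb{F}_{q^s}$-linear code spanned by $\{\mathrm{ev}_{X_N}(x_0^{d(\Delta)-i}x_1^i): i\in\Delta\}$, $\mathrm{PRS}(N,\Delta)_q=\mathrm{PRS}(N,\Delta)\cap\mathbb{F}_q^{N+1}$, and $\perp$ of a code denotes the Euclidean dual. For the set $\Delta$, $\Delta^\perp=\{\alpha\in\{0,1,\dots,N-1\}:\alpha\ne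 N-1-h\text{ for all }h\in\Delta\}$. Cyclotomic sets. Let $\mathbb{Z}_N=\{0\}\cup\mathbb{Z}/\langle N-1\rangle$, where the classes of $\mathbb{Z}/\langle N-1\rangle$ are represented by $\{1,\dots,N-1\}$ (so $0$ and $N-1$ are distinct and $q\cdot0=0$); $\mathbb{Z}_N$ is identified with $\{0,1,\dots,N-1\}$. $\mathfrak{I}_z=\{q^i\cdot z:i\ge0\}$ is the minimal cyclotomic set of $z$ with respect to $q$ and $n_z=|\mathfrak{I}_z|$. $\mathcal{A}$ is the set of least elements of the minimal cyclotomic sets. *)

theory Defs
  imports
    "HOL-Analysis.Cartesian_Space"
    "HOL-Computational_Algebra.Polynomial"
    "HOL-Computational_Algebra.Primes"
begin

(* The fields F_q and F_{q^s} are finite field types 'k and 'a; F_q is regarded as a subfield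
   of F_{q^s} through a homomorphism of fields (injective, since it maps 1 to 1). *)

definition field_embedding :: "('k::field \<Rightarrow> 'a::field) \<Rightarrow> bool" where
  "field_embedding \<iota> \<longleftrightarrow>
     \<iota> 1 = 1 \<and> (\<forall>x y. \<iota> (x + y) = \<iota> x + \<iota> y) \<and> (\<forall>x y. \<iota> (x * y) = \<iota> x * \<iota> y)"

definition Y_set :: "nat \<Rightarrow> 'a::field set" where
  "Y_set N = {z. z ^ N = z}"

definition X_set :: "nat \<Rightarrow> ('a::field \<times> 'a) set" where
  "X_set N = {(1, z) |z. z \<in> Y_set N} \<union> {(0, 1)}"

(* An element of F[x0, x1] is represented in F[x0][x1], i.e. as a polynomial in x1 whose
   coefficients are polynomials in x0. *)

definition eval2 :: "'a::comm_semiring_1 poly poly \<Rightarrow> 'a \<times> 'a \<Rightarrow> 'a" where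
  "eval2 f P = poly (poly f [:snd P:]) (fst P)"

definition monomial2 :: "nat \<Rightarrow> nat \<Rightarrow> 'a::comm_semiring_1 poly poly" where
  "monomial2 i j = monom (monom 1 i) j"

(* Sanity check: monomial2 i j is x0^i x1^j. *)
lemma eval2_monomial2: "eval2 (monomial2 i j) (x0, x1) = x0 ^ i * x1 ^ j"
  by (simp add: eval2_def monomial2_def poly_monom)

(* Codes live in F^'n, where pt :: 'n => F x F is the chosen enumeration of the points X_N. *)

definition ev :: "('n::finite \<Rightarrow> 'a \<times> 'a) \<Rightarrow> 'a::comm_semiring_1 poly poly \<Rightarrow> 'a ^ 'n" where
  "ev pt f = (\<chi> j. eval2 f (pt j))"

definition PRS :: "('n::finite \<Rightarrow> 'a \<times> 'a) \<Rightarrow> nat set \<Rightarrow> ('a::field ^ 'n) set" where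
  "PRS pt \<Delta> = vec.span ((\<lambda>i. ev pt (monomial2 (Max \<Delta> - i) i)) ` \<Delta>)"

definition subfield_subcode :: "('k \<Rightarrow> 'a) \<Rightarrow> ('a ^ 'n::finite) set \<Rightarrow> ('k ^ 'n) set" where
  "subfield_subcode \<iota> C = {c. (\<chi> j. \<iota> (c $ j)) \<in> C}"

definition dual_code :: "('k::field ^ 'n::finite) set \<Rightarrow> ('k ^ 'n) set" where
  "dual_code C = {v. \<forall>c\<in>C. (\<Sum>j\<in>UNIV. v $ j * c $ j) = 0}"

definition dual_exponents :: "nat \<Rightarrow> nat set \<Rightarrow> nat set" where
  "dual_exponents N \<Delta> = {\<alpha> \<in> {0..N - 1}. \<forall>h\<in>\<Delta>. \<alpha> \<noteq> N - 1 - h}"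

(* Representative in {0..N-1} of a natural number in {0} Un Z/(N-1): 0 stays 0, while a positive
   number is sent to the element of {1..N-1} congruent to it modulo N-1. *)

definition ZN_rep :: "nat \<Rightarrow> nat \<Rightarrow> nat" where
  "ZN_rep N m = (if m = 0 then 0 else (m - 1) mod (N - 1) + 1)"

definition cyclotomic_set :: "nat \<Rightarrow> nat \<Rightarrow> nat \<Rightarrow> nat set" where
  "cyclotomic_set N q z = {ZN_rep N (q ^ i * z) |i. True}"

definition cyclotomic_reps :: "nat \<Rightarrow> nat \<Rightarrow> nat set" where
  "cyclotomic_reps N q = (\<lambda>z. Min (cyclotomic_set N q z)) ` {0..N - 1}"

end

theory Submission
  imports Defs "HOL-Number_Theory.Cong"
begin

text \<open>Over \<open>F\<^sub>q\<close> dimensions can be read off from cardinalities. A word of \<open>PRS(N, \<Delta>)\<close> consists of the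
  values on \<open>Y\<^sub>N\<close> of a polynomial \<open>F\<close> with exponents in \<open>\<Delta>\<close>, together with the coefficient \<open>F d\<close> at the point
  \<open>(0, 1)\<close>. Comparing coefficients of \<open>F\<close> and its \<open>q\<close>-th power on \<open>Y\<^sub>N\<close>, its entries lie in \<open>F\<^sub>q\<close> iff
  \<open>F (q i) = (F i)\<^sup>q\<close> for all \<open>i\<close> and \<open>(F d)\<^sup>q = F d\<close>. Hence every cyclotomic set of size \<open>n\<close> inside \<open>\<Delta>\<close>
  contributes one free coefficient fixed by \<open>x \<mapsto> x^(q^n)\<close>, that is \<open>n\<close> dimensions, except that the set of \<open>d\<close>
  contributes a single one. The reflection \<open>z \<mapsto> N - 1 - z\<close> turns the cyclotomic sets not contained in \<open>\<Delta>\<close> into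
  those meeting \<open>\<Delta>\<^sup>\<bottom>\<close>.\<close>

section \<open>Finite fields and linear codes\<close>

text \<open>Multiplication by a nonzero \<open>x\<close> permutes the nonzero elements, so their
  product absorbs a factor \<open>x ^ (CARD('a) - 1)\<close>, which must be 1.\<close>

lemma finite_field_power_card:
  fixes x :: "'a::{field,finite}"
  shows "x ^ CARD('a) = x"
proof (cases "x = 0")
  case False
  have "x ^ (CARD('a) - 1) * \<Prod>(UNIV - {0}) = (\<Prod>y\<in>UNIV - {0}. x * y)"
    by (simp add: prod.distrib)
  also have "\<dots> = \<Prod>(UNIV - {0})"
    by (rule prod.reindex_bij_witness[of _ "\<lambda>y. y / x" "\<lambda>y. x * y"]) (use False in auto)
  finally have "x ^ (CARD('a) - 1) = 1"
    by simp
  then have "x ^ Suc (CARD('a) - 1) = x"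
    by (simp only: power_Suc mult_1_right)
  then show ?thesis
    by (simp only: Suc_diff_1 zero_less_card_finite)
qed (simp add: zero_power)

lemma of_nat_CARD_eq_0: "of_nat CARD('a) = (0 :: 'a::{ring_1,finite})"
proof -
  have "(\<Sum>x\<in>UNIV. x + 1) = (\<Sum>x\<in>(UNIV :: 'a set). x)"
    by (rule sum.reindex_bij_witness[of _ "\<lambda>y. y - 1" "\<lambda>y. y + 1"]) auto
  then show ?thesis
    by (simp add: sum.distrib)
qed

lemma CHAR_eq_if_CARD_prime_power:
  assumes "prime p" "CARD('a::{field,finite}) = p ^ k"
  shows "CHAR('a) = p"
proof -
  have "CHAR('a) dvd p ^ k"
    using of_nat_CARD_eq_0[where 'a = 'a] assms(2) of_nat_eq_0_iff_char_dvd by metis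
  moreover have "prime CHAR('a)"
    using prime_CHAR_semidom finite_imp_CHAR_pos by (metis finite_class.finite_UNIV)
  ultimately show ?thesis
    using assms(1) by (metis prime_dvd_power primes_dvd_imp_eq)
qed

text \<open>With \<open>r = M - 1\<close> and \<open>CARD('a) - 1 = r * t\<close>, every nonzero
  element is a root of X^(r t) - 1 = f * g, where \<open>f\<close> is X^r - 1. As \<open>g\<close>
  has at most \<open>r * (t - 1)\<close> roots, \<open>f\<close> has at least \<open>r\<close>, and
  0 is the remaining solution. This counts both \<open>Y_set N\<close> and the subfields fixed by
  powers of Frobenius.\<close>

lemma card_power_eq_self:
  assumes "M > 1" "(M - 1) dvd (CARD('a) - 1)"
  shows "card {x :: 'a::{field,finite}. x ^ M = x} = M"
proof -
  define r where "r = M - 1"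
  have r: "r > 0" "M = Suc r"
    using assms(1) by (auto simp: r_def)
  obtain t where t: "CARD('a) - 1 = r * t"
    using assms(2) by (auto simp: r_def)
  have "card {0, 1 :: 'a} \<le> CARD('a)"
    by (rule card_mono) auto
  then have K: "CARD('a) \<ge> 2"
    by simp
  then have "t > 0"
    using t by (cases t) auto
  define f where "f = monom 1 r - (1 :: 'a poly)"
  define g where "g = (\<Sum>i<t. monom 1 (r * i) :: 'a poly)"
  have poly_f: "poly f x = x ^ r - 1" for x
    by (simp add: f_def poly_monom)
  have poly_g: "poly g x = (\<Sum>i<t. (x ^ r) ^ i)" for x
    by (simp add: g_def poly_sum poly_monom power_mult)
  have "poly f 0 \<noteq> 0"
    using r by (simp add: poly_f zero_power)
  then have f0: "f \<noteq> 0"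
    by auto
  \<comment> \<open>At 0 only the summand \<open>i = 0\<close> survives, with value 1; hence
    \<open>g\<close> is nonzero and the root bound applies to it.\<close>
  have "poly g 0 = (\<Sum>i\<in>{0}. (0 ^ r) ^ i)"
    unfolding poly_g by (rule sum.mono_neutral_right) (use r \<open>t > 0\<close> in \<open>auto simp: zero_power\<close>)
  then have g0: "g \<noteq> 0"
    by auto
  have "degree f \<le> r"
    unfolding f_def by (intro degree_diff_le degree_monom_le) auto
  have deg_g: "degree g \<le> r * (t - 1)"
    unfolding g_def
    by (intro degree_sum_le) (auto intro!: order.trans[OF degree_monom_le] mult_le_mono2)
  have upper: "card {x. poly f x = 0} \<le> r"
    using card_poly_roots_bound[OF f0] \<open>degree f \<le> r\<close> by linarith
  have "(UNIV - {0} :: 'a set) \<subseteq> {x. poly f x = 0} \<union> {x. poly g x = 0}"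
  proof
    fix x :: 'a assume "x \<in> UNIV - {0}"
    moreover have "x * x ^ (r * t) = x"
      using finite_field_power_card[of x] t K by (metis One_nat_def Suc_diff_1 finite_UNIV_card_ge_0 finite_class.finite_UNIV power_Suc)
    ultimately have "(x ^ r) ^ t = 1"
      by (simp add: power_mult)
    then have "poly f x * poly g x = 0"
      by (simp add: poly_f poly_g flip: power_diff_1_eq)
    then show "x \<in> {x. poly f x = 0} \<union> {x. poly g x = 0}"
      by simp
  qed
  then have "card (UNIV - {0} :: 'a set) \<le> card ({x. poly f x = 0} \<union> {x. poly g x = 0})"
    by (rule card_mono[rotated]) simp
  also have "\<dots> \<le> card {x. poly f x = 0} + card {x. poly g x = 0}"
    by (rule card_Un_le)
  also have "card {x. poly g x = 0} \<le> r * (t - 1)"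
    using card_poly_roots_bound[OF g0] deg_g by linarith
  finally have "r * t \<le> card {x. poly f x = 0} + r * (t - 1)"
    using t by (simp add: card_Diff_singleton)
  moreover have "r * t = r * (t - 1) + r"
    using \<open>t > 0\<close> by (cases t) auto
  ultimately have "card {x. poly f x = 0} = r"
    using upper by linarith
  moreover have "{x :: 'a. x ^ M = x} = insert 0 {x. poly f x = 0}"
    by (auto simp: r poly_f)
  ultimately show ?thesis
    using \<open>poly f 0 \<noteq> 0\<close> r by simp
qed

section \<open>Cardinalities of subspaces and dual codes\<close>

lemma card_vec_span_independent:
  fixes B :: "('k::{field,finite} ^ 'n::finite) set"
  assumes "vec.independent B"
  shows "card (vec.span B) = CARD('k) ^ card B"
proof -
  have "finite B"
    using assms by (rule vec.finiteI_independent)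
  then show ?thesis
    using assms
  proof (induction B rule: finite_induct)
    case empty
    then show ?case by simp
  next
    case (insert b B)
    then have b: "b \<notin> vec.span B" and ind: "vec.independent B"
      by (auto simp: vec.independent_insert)
    \<comment> \<open>Since \<open>b\<close> lies outside the span of \<open>B\<close>, each vector
      of the larger span is \<open>t *s b + v\<close> for a unique pair, so every new basis vector
      multiplies the cardinality by \<open>CARD('k)\<close>.\<close>
    have "bij_betw (\<lambda>(t, v). t *s b + v) (UNIV \<times> vec.span B) (vec.span (insert b B))"
      unfolding bij_betw_def
    proof
      show "inj_on (\<lambda>(t, v). t *s b + v) (UNIV \<times> vec.span B)"
      proof (rule inj_onI, clarsimp)
        fix t v t' v'
        assume v: "v \<in> vec.span B" "v' \<in> vec.span B" and eq: "t *s b + v = t' *s b + v'"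
        then have "(t - t') *s b = v' - v"
          by (simp add: vec.scale_left_diff_distrib algebra_simps)
        then have "(t - t') *s b \<in> vec.span B"
          using v by (simp add: vec.span_diff)
        then have "inverse (t - t') *s ((t - t') *s b) \<in> vec.span B"
          by (rule vec.span_scale)
        then have "t = t'"
          using b by (cases "t = t'") (simp_all add: vec.scale_scale)
        with eq show "t = t' \<and> v = v'" by simp
      qed
      show "(\<lambda>(t, v). t *s b + v) ` (UNIV \<times> vec.span B) = vec.span (insert b B)"
      proof safe
        fix t v assume "v \<in> vec.span B"
        then show "t *s b + v \<in> vec.span (insert b B)"
          unfolding vec.span_insert by (auto intro!: exI[of _ t])
      next
        fix x assume "x \<in> vec.span (insert b B)"
        then obtain t where "x - t *s b \<in> vec.span B"
          unfolding vec.span_insert by auto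
        then show "x \<in> (\<lambda>(t, v). t *s b + v) ` (UNIV \<times> vec.span B)"
          by (intro image_eqI[of _ _ "(t, x - t *s b)"]) auto
      qed
    qed
    from bij_betw_same_card[OF this] show ?case
      using insert.IH[OF ind] insert.hyps by (simp add: card_cartesian_product)
  qed
qed

lemma card_vec_subspace:
  fixes S :: "('k::{field,finite} ^ 'n::finite) set"
  assumes "vec.subspace S"
  shows "card S = CARD('k) ^ vec.dim S"
  using vec.basis_subspace_exists[OF assms] card_vec_span_independent by metis

text \<open>A vector \<open>v\<close> of \<open>S\<close> is uniquely the sum of a multiple of
  \<open>x\<close>, namely \<open>(\<phi> v / \<phi> x) *s x\<close>, and a vector of the
  kernel.\<close>

lemma card_subspace_kernel:
  fixes S :: "('k::{field,finite} ^ 'n::finite) set" and \<phi> :: "'k ^ 'n \<Rightarrow> 'k"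
  assumes S: "vec.subspace S" and x: "x \<in> S" "\<phi> x \<noteq> 0"
    and add: "\<And>u v. \<phi> (u + v) = \<phi> u + \<phi> v" and scale: "\<And>c v. \<phi> (c *s v) = c * \<phi> v"
  shows "card S = CARD('k) * card {v \<in> S. \<phi> v = 0}"
proof -
  have minus: "\<phi> (u - v) = \<phi> u - \<phi> v" for u v
    using add[of "u - v" v] by simp
  have "bij_betw (\<lambda>(t, v). t *s x + v) (UNIV \<times> {v \<in> S. \<phi> v = 0}) S"
    by (rule bij_betw_byWitness[where f' = "\<lambda>v. (\<phi> v / \<phi> x, v - (\<phi> v / \<phi> x) *s x)"])
       (use S x in \<open>auto simp: add scale minus vec.subspace_add vec.subspace_diff vec.subspace_scale\<close>)
  from bij_betw_same_card[OF this] show ?thesis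
    by (simp add: card_cartesian_product)
qed

lemma subspace_dual_code: "vec.subspace (dual_code C)"
  by (auto simp: vec.subspace_def dual_code_def algebra_simps sum.distrib
      simp flip: sum_distrib_left)

text \<open>Double counting of the orthogonal pairs \<open>(v, c)\<close> with \<open>c \<in> C\<close>: every nonzero functional vanishes on a fraction \<open>1 / CARD('k)\<close> of the space.\<close>

lemma card_dual_code:
  fixes C :: "('k::{field,finite} ^ 'n::finite) set"
  assumes C: "vec.subspace C"
  shows "card (dual_code C) * card C = CARD('k) ^ CARD('n)"
proof -
  define q where "q = CARD('k)"
  define ip where "ip v c = (\<Sum>j\<in>UNIV. v $ j * c $ j)" for v c :: "'k ^ 'n"
  have ip: "ip (u + v) c = ip u c + ip v c" "ip (a *s v) c = a * ip v c"
    "ip c (u + v) = ip c u + ip c v" "ip c (a *s v) = a * ip c v" for u v c a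
    by (simp_all add: ip_def algebra_simps sum.distrib sum_distrib_left)
  have ip_axis: "ip (axis j 1) c = c $ j" for j c
    by (simp add: ip_def axis_def if_distrib[of "\<lambda>x. x * _"] cong: if_cong)
  define D where "D = dual_code C"
  have D: "v \<in> D \<longleftrightarrow> (\<forall>c\<in>C. ip v c = 0)" for v
    by (simp add: D_def dual_code_def ip_def)
  have q: "q > 1"
    using card_mono[of UNIV "{0, 1 :: 'k}"] by (simp add: q_def)
  have cardV: "CARD('k ^ 'n) = q ^ CARD('n)"
    by (simp add: q_def)
  \<comment> \<open>Both counts are multiplied by \<open>q\<close> so that no division occurs. For
    \<open>c \<noteq> 0\<close>, a unit vector at a nonzero entry of \<open>c\<close> shows that
    pairing with \<open>c\<close> is a nonzero functional.\<close>
  have col: "q * card {v. ip v c = 0} = (if c = 0 then q * q ^ CARD('n) else q ^ CARD('n))" for c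
  proof (cases "c = 0")
    case True
    then show ?thesis by (simp add: ip_def cardV[symmetric] del: CARD_vec)
  next
    case False
    then obtain j where "c $ j \<noteq> 0"
      by (auto simp: vec_eq_iff)
    then show ?thesis
      using card_subspace_kernel[of UNIV "axis j 1" "\<lambda>v. ip v c"] False
      by (simp add: ip ip_axis q_def del: CARD_vec) (simp add: cardV)
  qed
  have row: "q * card {c \<in> C. ip v c = 0} = (if v \<in> D then q * card C else card C)" for v
  proof (cases "v \<in> D")
    case True
    then have "{c \<in> C. ip v c = 0} = C" by (auto simp: D)
    then show ?thesis using True by simp
  next
    case False
    then obtain c where "c \<in> C" "ip v c \<noteq> 0" by (auto simp: D)
    then show ?thesis
      using card_subspace_kernel[OF C, of c "\<lambda>c. ip v c"] False
      by (simp add: ip q_def)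
  qed
  have "(\<Sum>c\<in>C. card {v. ip v c = 0}) = (\<Sum>v\<in>UNIV. card {c \<in> C. ip v c = 0})"
    using sum.swap_restrict[of C "UNIV :: ('k ^ 'n) set" "\<lambda>_ _. 1 :: nat" "\<lambda>c v. ip v c = 0"]
    by simp
  then have eq: "(\<Sum>c\<in>C. q * card {v. ip v c = 0}) = (\<Sum>v\<in>UNIV. q * card {c \<in> C. ip v c = 0})"
    by (simp flip: sum_distrib_left)
  have "0 \<in> C"
    using C by (rule vec.subspace_0)
  then have "(\<Sum>c\<in>C. q * card {v. ip v c = 0}) = q * q ^ CARD('n) + (card C - 1) * q ^ CARD('n)"
    unfolding col by (simp add: sum.remove[of C 0] card_Diff_singleton)
  moreover have "card C > 0"
    using \<open>0 \<in> C\<close> by (auto simp: card_gt_0_iff)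
  moreover have "(\<Sum>v\<in>UNIV. q * card {c \<in> C. ip v c = 0})
      = card D * (q * card C) + (q ^ CARD('n) - card D) * card C"
    unfolding row
    by (subst sum.If_cases) (simp_all add: Compl_eq_Diff_UNIV card_Diff_subset q_def)
  moreover have "card D \<le> q ^ CARD('n)"
    unfolding cardV[symmetric] by (rule card_mono) auto
  \<comment> \<open>The two totals are compared over the integers, where differences are not
    truncated; the terms \<open>card C * q ^ CARD('n)\<close> cancel and leave the common factor
    \<open>q - 1\<close>.\<close>
  ultimately have "int q * int q ^ CARD('n) + (int (card C) - 1) * int q ^ CARD('n)
      = int (card D) * (int q * int (card C)) + (int q ^ CARD('n) - int (card D)) * int (card C)"
    using eq by (metis (no_types, lifting) One_nat_def Suc_leI int_ops(2) of_nat_add of_nat_diff of_nat_mult of_nat_power)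
  then have "(int q - 1) * int q ^ CARD('n) = (int q - 1) * (int (card D) * int (card C))"
    by (simp add: algebra_simps)
  then have "int q ^ CARD('n) = int (card D) * int (card C)"
    using q by simp
  then have "q ^ CARD('n) = card D * card C"
    by (metis of_nat_eq_iff of_nat_mult of_nat_power)
  then show ?thesis
    by (simp add: D_def q_def)
qed

section \<open>Cyclotomic sets\<close>

text \<open>By \<open>shift\<close>, a coincidence of two values persists along the sequence, and
  the return \<open>f s = f 0\<close> makes it purely periodic. Its least period is the number of
  its values; for cyclotomic sets this shows that their size divides \<open>s\<close>.\<close>

lemma periodic_sequence:
  fixes f :: "nat \<Rightarrow> 'b"
  assumes shift: "\<And>i j k. f i = f j \<Longrightarrow> f (i + k) = f (j + k)" and s: "s > 0" "f s = f 0"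
  shows "card (range f) > 0" "card (range f) dvd s"
    "f i = f j \<longleftrightarrow> i mod card (range f) = j mod card (range f)"
proof -
  define p where "p = (LEAST p. p > 0 \<and> f p = f 0)"
  have p: "p > 0" "f p = f 0"
    using LeastI[of "\<lambda>p. p > 0 \<and> f p = f 0" s] s by (auto simp: p_def)
  have least: "f k \<noteq> f 0" if "0 < k" "k < p" for k
    using not_less_Least[of k "\<lambda>p. p > 0 \<and> f p = f 0"] that by (auto simp: p_def)
  have step: "f (i + p * k) = f i" for i k
  proof (induction k)
    case (Suc k)
    have "f (0 + (i + p * k)) = f (p + (i + p * k))"
      by (rule shift) (simp add: p)
    then show ?case using Suc by (simp add: algebra_simps)
  qed simp
  have f_mod: "f i = f (i mod p)" for i
    using step[of "i mod p" "i div p"] by simp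
  \<comment> \<open>Shifting both indices by \<open>p - j\<close> would turn a coincidence into a
    return to \<open>f 0\<close> after \<open>i + (p - j)\<close> steps, fewer than the least period
    \<open>p\<close>.\<close>
  have neq: "f i \<noteq> f j" if "i < j" "j < p" for i j
  proof
    assume "f i = f j"
    then have "f (i + (p - j)) = f 0"
      using shift[of i j "p - j"] that p by simp
    then show False
      using least[of "i + (p - j)"] that by linarith
  qed
  have inj: "inj_on f {..<p}"
    using neq by (auto simp: inj_on_def) (metis nat_neq_iff)
  have "range f = f ` {..<p}"
    using f_mod p by (auto simp: image_iff) (metis lessThan_iff mod_less_divisor)
  then have card: "card (range f) = p"
    by (simp add: card_image inj)
  have iff: "f i = f j \<longleftrightarrow> i mod p = j mod p" for i j
    using f_mod[of i] f_mod[of j] inj p by (auto simp: inj_on_def)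
  show "card (range f) > 0" "f i = f j \<longleftrightarrow> i mod card (range f) = j mod card (range f)"
    using p iff by (simp_all add: card)
  show "card (range f) dvd s"
    using iff[of s 0] s by (simp add: card mod_eq_0_iff_dvd)
qed

lemma cyclotomic_set_eq_range: "cyclotomic_set N q z = range (\<lambda>i. ZN_rep N (q ^ i * z))"
  by (auto simp: cyclotomic_set_def)

section \<open>Arithmetic of representatives in Z_N\<close>

lemma ZN_rep_less: "N > 1 \<Longrightarrow> ZN_rep N m < N"
  using mod_less_divisor[of "N - 1" "m - 1"] by (simp add: ZN_rep_def less_diff_conv)

lemma ZN_rep_eq_self: "m < N \<Longrightarrow> ZN_rep N m = m"
  by (auto simp: ZN_rep_def)

lemma ZN_rep_eq_0_iff [simp]: "ZN_rep N m = 0 \<longleftrightarrow> m = 0"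
  by (simp add: ZN_rep_def)

lemma ZN_rep_mod: "ZN_rep N m mod (N - 1) = m mod (N - 1)"
proof (cases "m = 0")
  case False
  then have "m = Suc (m - 1)" by simp
  then show ?thesis
    by (metis False Suc_eq_plus1 ZN_rep_def mod_Suc_eq)
qed (simp add: ZN_rep_def)

text \<open>0 and \<open>N - 1\<close> have the same residue, so the first conjunct is what keeps
  them apart. For positive numbers the subtraction of 1 in the representative is cancelled from the
  congruence.\<close>

lemma ZN_rep_eq_iff:
  "ZN_rep N m = ZN_rep N m' \<longleftrightarrow> (m = 0 \<longleftrightarrow> m' = 0) \<and> m mod (N - 1) = m' mod (N - 1)"
proof
  assume "ZN_rep N m = ZN_rep N m'"
  then show "(m = 0 \<longleftrightarrow> m' = 0) \<and> m mod (N - 1) = m' mod (N - 1)"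
    by (metis ZN_rep_mod ZN_rep_eq_0_iff)
next
  assume R: "(m = 0 \<longleftrightarrow> m' = 0) \<and> m mod (N - 1) = m' mod (N - 1)"
  show "ZN_rep N m = ZN_rep N m'"
  proof (cases "m = 0")
    case False
    with R have "m = Suc (m - 1)" "m' = Suc (m' - 1)" by auto
    then have "[Suc (m - 1) = Suc (m' - 1)] (mod (N - 1))"
      using R by (simp add: cong_def)
    then have "[m - 1 = m' - 1] (mod (N - 1))"
      using cong_add_rcancel_nat[of "m - 1" 1 "m' - 1" "N - 1"] by simp
    then show ?thesis
      using False R by (auto simp: ZN_rep_def cong_def)
  qed (use R in simp)
qed

lemma ZN_rep_mult_ZN_rep [simp]: "ZN_rep N (k * ZN_rep N m) = ZN_rep N (k * m)"
proof -
  have "k * ZN_rep N m mod (N - 1) = k * m mod (N - 1)"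
    by (rule mod_mult_cong[OF refl ZN_rep_mod])
  then show ?thesis
    by (simp add: ZN_rep_eq_iff)
qed

text \<open>A nonzero \<open>z\<close> satisfies \<open>z ^ (N - 1) = 1\<close> and sees only the
  residue of the exponent; \<open>z = 0\<close> sees only whether the exponent is 0. Both data
  survive in \<open>ZN_rep N m\<close>.\<close>

lemma power_ZN_rep:
  fixes z :: "'a::field"
  assumes "N > 1" "z ^ N = z"
  shows "z ^ ZN_rep N m = z ^ m"
proof (cases "z = 0 \<or> m = 0")
  case False
  have "z * z ^ (N - 1) = z"
    using assms by (metis Suc_diff_1 less_trans power_Suc zero_less_one)
  then have one: "z ^ (N - 1) = 1"
    using False by simp
  have mod: "z ^ k = z ^ (k mod (N - 1))" for k
  proof -
    have "z ^ k = z ^ ((N - 1) * (k div (N - 1)) + k mod (N - 1))"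
      by simp
    also have "\<dots> = z ^ (k mod (N - 1))"
      unfolding power_add power_mult one by simp
    finally show ?thesis .
  qed
  show ?thesis
    using mod[of m] mod[of "ZN_rep N m"] by (simp only: ZN_rep_mod)
next
  case True
  then show ?thesis
    by (cases "m = 0") (simp_all add: ZN_rep_def zero_power)
qed

text \<open>The divisibility makes \<open>q ^ s\<close> congruent to 1 modulo \<open>N - 1\<close>,
  so multiplication by \<open>q\<close> permutes Z_N and the cyclotomic sets are its orbits.\<close>

locale cyclotomic =
  fixes N q s :: nat
  assumes N: "N > 1" and q: "q > 1" and s: "s > 0" and dvd: "(N - 1) dvd (q ^ s - 1)"
begin

abbreviation "I \<equiv> cyclotomic_set N q"

lemma ZN_rep_power_s: "ZN_rep N (q ^ (s * i) * z) = ZN_rep N z"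
proof -
  have "q ^ s mod (N - 1) = 1 mod (N - 1)"
    using dvd q by (subst mod_eq_dvd_iff_nat) auto
  then have "[q ^ (s * i) = 1] (mod (N - 1))"
    by (metis cong_def cong_pow power_mult power_one)
  then have "[q ^ (s * i) * z = 1 * z] (mod (N - 1))"
    by (rule cong_scalar_right)
  then show ?thesis
    using q by (simp add: ZN_rep_eq_iff cong_def)
qed

lemma orbit_shift:
  "ZN_rep N (q ^ i * z) = ZN_rep N (q ^ j * z) \<Longrightarrow>
    ZN_rep N (q ^ (i + k) * z) = ZN_rep N (q ^ (j + k) * z)"
  using ZN_rep_mult_ZN_rep[of N "q ^ k" "q ^ i * z"] ZN_rep_mult_ZN_rep[of N "q ^ k" "q ^ j * z"]
  by (simp add: power_add mult_ac del: ZN_rep_mult_ZN_rep)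

lemma period:
  shows "card (I z) > 0" and "card (I z) dvd s"
    and "ZN_rep N (q ^ i * z) = ZN_rep N (q ^ j * z) \<longleftrightarrow> i mod card (I z) = j mod card (I z)"
  using periodic_sequence[of "\<lambda>i. ZN_rep N (q ^ i * z)" s, OF orbit_shift s]
    ZN_rep_power_s[of 1 z]
  by (simp_all add: cyclotomic_set_eq_range)

lemma cyclotomic_set_subset: "I z \<subseteq> {..<N}"
  using N by (auto simp: cyclotomic_set_def ZN_rep_less)

lemma finite_cyclotomic_set [simp]: "finite (I z)"
  using cyclotomic_set_subset finite_subset by blast

lemma mem_cyclotomic_set_self: "z < N \<Longrightarrow> z \<in> I z"
  unfolding cyclotomic_set_eq_range by (rule image_eqI[of _ _ 0]) (auto simp: ZN_rep_eq_self)

lemma cyclotomic_set_eqI: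
  assumes "z < N" "y \<in> I z"
  shows "I y = I z"
proof -
  have sub: "I v \<subseteq> I u" if "v \<in> I u" for u v
  proof -
    from that obtain i where i: "v = ZN_rep N (q ^ i * u)"
      by (auto simp: cyclotomic_set_def)
    show ?thesis
      unfolding i cyclotomic_set_eq_range by (auto simp flip: power_add mult.assoc)
  qed
  obtain i where i: "y = ZN_rep N (q ^ i * z)"
    using assms by (auto simp: cyclotomic_set_def)
  \<comment> \<open>\<open>q ^ (s * i)\<close> acts as the identity, so multiplication by
    \<open>q ^ (s * i - i)\<close> leads back from \<open>y\<close> to \<open>z\<close>. Membership
    is thus symmetric, and the cyclotomic sets form a partition.\<close>
  have "s * i - i + i = s * i"
    using s by (cases s) simp_all
  then have "ZN_rep N (q ^ (s * i - i) * y) = z"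
    unfolding i ZN_rep_mult_ZN_rep mult.assoc[symmetric] power_add[symmetric]
    using assms by (simp add: ZN_rep_power_s ZN_rep_eq_self)
  then have "z \<in> I y"
    by (auto simp: cyclotomic_set_def)
  then show ?thesis
    using sub assms by blast
qed

abbreviation "reps \<equiv> cyclotomic_reps N q"

lemma Min_cyclotomic_set_mem:
  assumes "z < N"
  shows "Min (I z) \<in> I z"
  using mem_cyclotomic_set_self[OF assms] by (intro Min_in) auto

lemma reps_less:
  assumes "a \<in> reps"
  shows "a < N"
proof -
  obtain x where "a = Min (I x)" "x < N"
    using assms N by (auto simp: cyclotomic_reps_def)
  then show ?thesis
    using cyclotomic_set_subset Min_cyclotomic_set_mem by blast
qed

lemma finite_reps [simp]: "finite reps"
  by (simp add: cyclotomic_reps_def)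

lemma ex_rep:
  assumes "z < N"
  obtains a where "a \<in> reps" "z \<in> I a"
proof -
  have "I (Min (I z)) = I z"
    using cyclotomic_set_eqI Min_cyclotomic_set_mem assms by blast
  then have "z \<in> I (Min (I z))"
    using mem_cyclotomic_set_self[OF assms] by blast
  with that[of "Min (I z)"] show ?thesis
    using assms by (auto simp: cyclotomic_reps_def)
qed

lemma rep_unique:
  assumes "a \<in> reps" "b \<in> reps" "z \<in> I a" "z \<in> I b"
  shows "a = b"
proof -
  have Min: "c = Min (I c)" if "c \<in> reps" for c
  proof -
    from that obtain x where x: "c = Min (I x)" "x < N"
      using N by (auto simp: cyclotomic_reps_def)
    then show ?thesis
      using cyclotomic_set_eqI[OF _ Min_cyclotomic_set_mem] by simp
  qed
  have "I a = I b"
    using assms cyclotomic_set_eqI reps_less by metis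
  then show ?thesis
    using Min assms by metis
qed

text \<open>Since \<open>P\<close> depends only on the cyclotomic set, it is constant on every class
  of the partition. Sums over representatives thereby become counts of exponents, which can be
  transported along bijections.\<close>

lemma sum_card_reps:
  "(\<Sum>a | a \<in> reps \<and> P (I a). card (I a)) = card {z. z < N \<and> P (I z)}"
proof -
  have "{z. z < N \<and> P (I z)} = (\<Union>a\<in>{a \<in> reps. P (I a)}. I a)"
  proof safe
    fix z assume "z < N" "P (I z)"
    then show "z \<in> (\<Union>a\<in>{a \<in> reps. P (I a)}. I a)"
      by (metis (mono_tags, lifting) UN_I cyclotomic_set_eqI ex_rep mem_Collect_eq reps_less)
  next
    fix z a assume "a \<in> reps" "P (I a)" "z \<in> I a"
    then show "z < N" "P (I z)"
      using cyclotomic_set_subset cyclotomic_set_eqI reps_less by (blast, metis)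
  qed
  also have "card \<dots> = (\<Sum>a | a \<in> reps \<and> P (I a). card (I a))"
    by (rule card_UN_disjoint) (auto dest: rep_unique)
  finally show ?thesis ..
qed

section \<open>Reflection of exponents and the dual exponents\<close>

lemma coprime_power_q: "coprime (q ^ i) (N - 1)"
proof -
  have "coprime (q ^ s) (q ^ s - 1)"
    using q by (intro coprime_diff_one_right_nat) simp
  then have "coprime (q ^ s) (N - 1)"
    using dvd coprime_divisors dvd_refl by blast
  then show ?thesis
    using s by simp
qed

text \<open>For \<open>0 < z < N - 1\<close> the two reduced products add up to a multiple of
  \<open>N - 1\<close> that lies strictly between 0 and \<open>2 * (N - 1)\<close>; the upper end is
  excluded because \<open>N - 1\<close> would divide \<open>z\<close> by coprimality. The end points
  0 and \<open>N - 1\<close> are fixed by multiplication and exchanged by reflection.\<close>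

lemma ZN_rep_complement:
  assumes "z < N" and k: "coprime k (N - 1)" "k > 0"
  shows "ZN_rep N (k * (N - 1 - z)) = N - 1 - ZN_rep N (k * z)"
proof -
  consider "z = 0" | "z = N - 1" | "0 < z" "z < N - 1"
    using assms by linarith
  then show ?thesis
  proof cases
    case 1
    have "ZN_rep N (k * (N - 1)) = ZN_rep N (N - 1)"
      using k N by (simp add: ZN_rep_eq_iff)
    then show ?thesis
      using 1 N by (simp add: ZN_rep_eq_self)
  next
    case 2
    have "ZN_rep N (k * (N - 1)) = ZN_rep N (N - 1)"
      using k N by (simp add: ZN_rep_eq_iff)
    then show ?thesis
      using 2 N by (simp add: ZN_rep_eq_self)
  next
    case 3
    define x y where "x = ZN_rep N (k * z)" and "y = ZN_rep N (k * (N - 1 - z))"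
    have "x \<noteq> 0" "y \<noteq> 0"
      using 3 k by (simp_all add: x_def y_def)
    moreover have "x < N" "y < N"
      using N by (simp_all add: x_def y_def ZN_rep_less)
    ultimately have xy: "0 < x" "0 < y" "x < N" "y < N"
      by auto
    have "[x + y = k * z + k * (N - 1 - z)] (mod (N - 1))"
      unfolding x_def y_def cong_def by (metis ZN_rep_mod mod_add_eq)
    also have "k * z + k * (N - 1 - z) = k * (N - 1)"
      using 3 by (simp flip: distrib_left)
    finally have "(N - 1) dvd (x + y)"
      by (simp add: cong_def mod_eq_0_iff_dvd)
    then obtain c where c: "x + y = (N - 1) * c"
      by blast
    have "x \<noteq> N - 1"
    proof
      assume "x = N - 1"
      then have "(N - 1) dvd k * z"
        using ZN_rep_mod[of N "k * z"] by (simp add: x_def mod_eq_0_iff_dvd)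
      then have "(N - 1) dvd z"
        using k by (simp add: coprime_commute coprime_dvd_mult_right_iff)
      then show False
        using 3 by (auto dest: dvd_imp_le)
    qed
    then have "(N - 1) * c < (N - 1) * 2"
      using xy unfolding c[symmetric] by linarith
    then have "c < 2"
      by simp
    moreover have "c \<noteq> 0"
      using c xy by (intro notI) simp
    ultimately have "c = 1"
      by simp
    then show ?thesis
      using c by (simp add: x_def y_def)
  qed
qed

text \<open>An exponent below \<open>N\<close> is a dual exponent exactly when its reflection is
  missing from \<Delta>. As reflection maps cyclotomic sets to cyclotomic sets, it exchanges the two
  conditions.\<close>

lemma card_meeting_dual_exponents:
  assumes "\<Delta> \<subseteq> {..<N}"
  shows "card {z. z < N \<and> I z \<inter> dual_exponents N \<Delta> \<noteq> {}} = card {z. z < N \<and> \<not> I z \<subseteq> \<Delta>}"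
proof -
  have mem: "N - 1 - y \<in> dual_exponents N \<Delta> \<longleftrightarrow> y \<notin> \<Delta>" if "y < N" for y
  proof -
    have "N - 1 - y = N - 1 - h \<longleftrightarrow> y = h" if "h \<in> \<Delta>" for h
      using \<open>y < N\<close> that assms by (auto dest!: subsetD)
    then show ?thesis
      by (auto simp: dual_exponents_def)
  qed
  have image: "I (N - 1 - z) = (\<lambda>y. N - 1 - y) ` I z" if "z < N" for z
    using ZN_rep_complement[OF that coprime_power_q] q by (simp add: cyclotomic_set_eq_range image_image)
  have iff: "I (N - 1 - z) \<inter> dual_exponents N \<Delta> \<noteq> {} \<longleftrightarrow> \<not> I z \<subseteq> \<Delta>" if "z < N" for z
  proof -
    have "N - 1 - y \<in> dual_exponents N \<Delta> \<longleftrightarrow> y \<notin> \<Delta>" if "y \<in> I z" for y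
      using mem that cyclotomic_set_subset by blast
    then show ?thesis
      unfolding image[OF that] by blast
  qed
  have "bij_betw (\<lambda>z. N - 1 - z) {z. z < N \<and> \<not> I z \<subseteq> \<Delta>}
      {z. z < N \<and> I z \<inter> dual_exponents N \<Delta> \<noteq> {}}"
  proof (rule bij_betw_byWitness[where f' = "\<lambda>z. N - 1 - z"])
    show "(\<lambda>z. N - 1 - z) ` {z. z < N \<and> I z \<inter> dual_exponents N \<Delta> \<noteq> {}}
        \<subseteq> {z. z < N \<and> \<not> I z \<subseteq> \<Delta>}"
    proof clarify
      fix z assume z: "z < N" and *: "I z \<inter> dual_exponents N \<Delta> \<noteq> {}"
      have "N - 1 - (N - 1 - z) = z" "N - 1 - z < N"
        using z by auto
      with * show "N - 1 - z < N \<and> \<not> I (N - 1 - z) \<subseteq> \<Delta>"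
        using iff[of "N - 1 - z"] by simp
    qed
  qed (use iff N in auto)
  then show ?thesis
    by (simp add: bij_betw_same_card)
qed

end

section \<open>Frobenius-equivariant coefficient functions\<close>

lemma power_power_mod:
  fixes x :: "'a::monoid_mult"
  assumes "x ^ (q ^ n) = x"
  shows "x ^ (q ^ (k mod n)) = x ^ (q ^ k)"
proof -
  have "x ^ (q ^ (n * j)) = x" for j
    by (induction j) (simp_all add: power_add power_mult assms)
  then have "x ^ (q ^ (n * (k div n) + k mod n)) = x ^ (q ^ (k mod n))"
    unfolding power_add power_mult by (metis power_mult)
  then show ?thesis
    by simp
qed

context cyclotomic
begin

lemma equivariant_orbit:
  fixes F :: "nat \<Rightarrow> 'a::field"
  assumes "\<And>i. i < N \<Longrightarrow> F (ZN_rep N (q * i)) = F i ^ q" and "a < N"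
  shows "F (ZN_rep N (q ^ k * a)) = F a ^ (q ^ k)"
proof (induction k)
  case 0
  then show ?case using assms by (simp add: ZN_rep_eq_self)
next
  case (Suc k)
  have "F (ZN_rep N (q ^ Suc k * a)) = F (ZN_rep N (q * ZN_rep N (q ^ k * a)))"
    by (simp add: mult.assoc)
  also have "\<dots> = (F a ^ (q ^ k)) ^ q"
    using assms(1) Suc N by (simp add: ZN_rep_less del: ZN_rep_mult_ZN_rep)
  finally show ?case
    by (simp add: mult.commute flip: power_mult)
qed

text \<open>Equivariance spreads the value at a representative \<open>a\<close> over its cyclotomic
  set, and the only constraint on this value comes from returning to \<open>a\<close> after
  \<open>card (I a)\<close> steps. The values at the representatives can therefore be prescribed
  independently; vanishing from \<open>N\<close> on removes any other freedom.\<close>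

lemma card_equivariant:
  fixes T :: "nat \<Rightarrow> 'a::field set"
  assumes T: "\<And>a. a \<in> reps \<Longrightarrow> T a \<subseteq> {x. x ^ (q ^ card (I a)) = x}"
  shows "card {F. (\<forall>i\<ge>N. F i = 0) \<and> (\<forall>i<N. F (ZN_rep N (q * i)) = F i ^ q) \<and> (\<forall>a\<in>reps. F a \<in> T a)}
    = (\<Prod>a\<in>reps. card (T a))" (is "card ?S = _")
proof -
  have "bij_betw (\<lambda>F. restrict F reps) ?S (PiE reps T)"
    unfolding bij_betw_def
  proof
    show "inj_on (\<lambda>F. restrict F reps) ?S"
    proof (rule inj_onI, rule ext)
      fix F G i assume F: "F \<in> ?S" and G: "G \<in> ?S" and eq: "restrict F reps = restrict G reps"
      show "F i = G i"
      proof (cases "i < N")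
        case True
        then obtain a where a: "a \<in> reps" "i \<in> I a"
          by (rule ex_rep)
        then obtain k where k: "i = ZN_rep N (q ^ k * a)"
          by (auto simp: cyclotomic_set_def)
        have "F a = G a"
          using eq a by (metis restrict_apply')
        then show ?thesis
          unfolding k using equivariant_orbit[of F a] equivariant_orbit[of G a] F G reps_less[OF a(1)]
          by simp
      qed (use F G in simp)
    qed
    show "(\<lambda>F. restrict F reps) ` ?S = PiE reps T"
    proof
      show "PiE reps T \<subseteq> (\<lambda>F. restrict F reps) ` ?S"
      proof
        fix g assume g: "g \<in> PiE reps T"
        have "\<forall>i\<in>{..<N}. \<exists>a k. a \<in> reps \<and> i = ZN_rep N (q ^ k * a)"
        proof
          fix i assume "i \<in> {..<N}"
          then obtain a where "a \<in> reps" "i \<in> I a"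
            using ex_rep by blast
          then show "\<exists>a k. a \<in> reps \<and> i = ZN_rep N (q ^ k * a)"
            by (auto simp: cyclotomic_set_def)
        qed
        then obtain r \<kappa> where r: "\<And>i. i < N \<Longrightarrow> r i \<in> reps \<and> i = ZN_rep N (q ^ \<kappa> i * r i)"
          by (metis lessThan_iff)
        \<comment> \<open>\<open>r i\<close> is the representative of \<open>i\<close>, and
          \<open>\<kappa> i\<close> is some number of steps from it to \<open>i\<close>. The choice
          of \<open>\<kappa> i\<close> is harmless: two choices agree modulo
          \<open>card (I a)\<close>, and \<open>g a\<close> is fixed by the corresponding power
          map.\<close>
        define F where "F i = (if i < N then g (r i) ^ (q ^ \<kappa> i) else 0)" for i
        have F: "F (ZN_rep N (q ^ k * a)) = g a ^ (q ^ k)" if a: "a \<in> reps" for a k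
        proof -
          define i where "i = ZN_rep N (q ^ k * a)"
          have "i < N"
            unfolding i_def using N by (rule ZN_rep_less)
          have "i \<in> I a"
            by (auto simp: i_def cyclotomic_set_def)
          moreover have "i \<in> I (r i)"
            using r[OF \<open>i < N\<close>] by (auto simp: cyclotomic_set_def)
          ultimately have "r i = a"
            using rep_unique a r[OF \<open>i < N\<close>] by blast
          then have "ZN_rep N (q ^ \<kappa> i * a) = ZN_rep N (q ^ k * a)"
            using r[OF \<open>i < N\<close>] i_def by metis
          then have mod: "\<kappa> i mod card (I a) = k mod card (I a)"
            by (simp add: period)
          have "g a ^ (q ^ card (I a)) = g a"
            using g T a by (auto simp: PiE_iff)
          then have "g a ^ (q ^ \<kappa> i) = g a ^ (q ^ k)"
            using mod power_power_mod by metis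
          then show ?thesis
            using \<open>i < N\<close> \<open>r i = a\<close> by (simp add: F_def flip: i_def)
        qed
        have "F (ZN_rep N (q * i)) = F i ^ q" if less: "i < N" for i
        proof -
          obtain a k where a: "a \<in> reps" and i: "i = ZN_rep N (q ^ k * a)"
            using r[OF less] by blast
          have "ZN_rep N (q * i) = ZN_rep N (q ^ Suc k * a)"
            by (simp add: i mult.assoc)
          then show ?thesis
            using F[OF a, of "Suc k"] F[OF a, of k] i by (simp add: mult.commute flip: power_mult)
        qed
        moreover have F_rep: "F a = g a" if "a \<in> reps" for a
          using F[OF that, of 0] reps_less[OF that] by (simp add: ZN_rep_eq_self)
        ultimately have "F \<in> ?S"
          using g by (auto simp: F_def PiE_iff)
        moreover have "g = restrict F reps"
          using g F_rep by (auto simp: PiE_iff extensional_def restrict_def)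
        ultimately show "g \<in> (\<lambda>F. restrict F reps) ` ?S"
          by blast
      qed
    qed auto
  qed
  then show ?thesis
    by (simp add: bij_betw_same_card card_PiE)
qed

lemma card_fixed_power:
  assumes "CARD('a::{field,finite}) = q ^ s" "n > 0" "n dvd s"
  shows "card {x :: 'a. x ^ (q ^ n) = x} = q ^ n"
proof (rule card_power_eq_self)
  show "q ^ n > 1"
    using q assms(2) by (rule one_less_power)
  obtain k where k: "s = n * k"
    using assms by blast
  have "int (q ^ n) - 1 dvd int (q ^ n) ^ k - 1 ^ k"
    by (simp add: power_diff_1_eq)
  then have "int (q ^ n - 1) dvd int (q ^ s - 1)"
    using q by (simp add: k of_nat_diff power_mult)
  then show "q ^ n - 1 dvd CARD('a) - 1"
    by (simp only: assms(1) int_dvd_int_iff)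
qed

text \<open>The second factor will turn out to be the cardinality of the dual code; the product form
  avoids subtracting exponents.\<close>

lemma card_equivariant_supported:
  fixes \<Delta> :: "nat set" and d :: nat
  assumes card: "CARD('a::{field,finite}) = q ^ s" and \<Delta>: "\<Delta> \<subseteq> {..<N}" "d \<in> \<Delta>"
  shows "card {F :: nat \<Rightarrow> 'a. (\<forall>i. i \<notin> \<Delta> \<longrightarrow> F i = 0) \<and>
        (\<forall>i<N. F (ZN_rep N (q * i)) = F i ^ q) \<and> F d ^ q = F d} *
      q ^ (card {z. z < N \<and> \<not> I z \<subseteq> \<Delta>} + (if I d \<subseteq> \<Delta> then card (I d) else 1)) = q ^ (N + 1)"
    (is "card ?S * _ = _")
proof -
  \<comment> \<open>\<open>T a\<close> collects the admissible values at \<open>a\<close>, and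
    \<open>e a\<close> is the exponent of \<open>q\<close> in its cardinality: only 0 when the
    cyclotomic set leaves \<Delta>, the subfield of order \<open>q\<close> on the set of
    \<open>d\<close>, and otherwise the subfield of order \<open>q ^ card (I a)\<close>.\<close>
  define T :: "nat \<Rightarrow> 'a set" where "T a = (if I a \<subseteq> \<Delta> then
      if d \<in> I a then {x. x ^ q = x} else {x. x ^ (q ^ card (I a)) = x} else {0})" for a
  define e where "e a = (if I a \<subseteq> \<Delta> then if d \<in> I a then 1 else card (I a) else 0)" for a
  have fixed: "x ^ (q ^ k) = x" if "x ^ q = x" for x :: 'a and k
    by (induction k) (simp_all add: power_mult that)
  have d: "d < N"
    using \<Delta> by auto
  have "?S = {F. (\<forall>i\<ge>N. F i = 0) \<and> (\<forall>i<N. F (ZN_rep N (q * i)) = F i ^ q) \<and> (\<forall>a\<in>reps. F a \<in> T a)}"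
    (is "_ = ?S'")
  proof (intro subset_antisym subsetI)
    fix F assume "F \<in> ?S"
    then have supp: "\<And>i. i \<notin> \<Delta> \<Longrightarrow> F i = 0" and Fd: "F d ^ q = F d"
      and eqv: "\<And>i. i < N \<Longrightarrow> F (ZN_rep N (q * i)) = F i ^ q"
      by auto
    have "F a \<in> T a" if a: "a \<in> reps" for a
    proof (cases "I a \<subseteq> \<Delta>")
      case False
      then obtain k where "ZN_rep N (q ^ k * a) \<notin> \<Delta>"
        by (auto simp: cyclotomic_set_def)
      then have "F a ^ (q ^ k) = 0"
        using equivariant_orbit[of F, OF eqv reps_less[OF a]] supp by metis
      then show ?thesis
        using False by (simp add: T_def)
    next
      case True
      show ?thesis
      proof (cases "d \<in> I a")
        case True
        then have "a \<in> I d"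
          using cyclotomic_set_eqI mem_cyclotomic_set_self reps_less[OF a] by metis
        then obtain k where k: "a = ZN_rep N (q ^ k * d)"
          by (auto simp: cyclotomic_set_def)
        have "F a = F d ^ (q ^ k)"
          unfolding k by (rule equivariant_orbit[of F, OF eqv d])
        then have "F a ^ q = F a"
          using Fd fixed by simp
        then show ?thesis
          using \<open>I a \<subseteq> \<Delta>\<close> True by (simp add: T_def)
      next
        case False
        have "ZN_rep N (q ^ card (I a) * a) = ZN_rep N (q ^ 0 * a)"
          unfolding period by simp
        then have "F a ^ (q ^ card (I a)) = F a"
          using equivariant_orbit[of F, OF eqv reps_less[OF a], of "card (I a)"] reps_less[OF a]
          by (simp add: ZN_rep_eq_self)
        then show ?thesis
          using \<open>I a \<subseteq> \<Delta>\<close> False by (simp add: T_def)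
      qed
    qed
    moreover have "F i = 0" if "i \<ge> N" for i
      using that \<Delta> by (intro supp) auto
    ultimately show "F \<in> ?S'"
      using eqv by simp
  next
    fix F assume "F \<in> ?S'"
    then have supp: "\<And>i. i \<ge> N \<Longrightarrow> F i = 0" and FT: "\<And>a. a \<in> reps \<Longrightarrow> F a \<in> T a"
      and eqv: "\<And>i. i < N \<Longrightarrow> F (ZN_rep N (q * i)) = F i ^ q"
      by auto
    have "F i = 0" if i: "i \<notin> \<Delta>" for i
    proof (cases "i < N")
      case True
      then obtain a where a: "a \<in> reps" "i \<in> I a"
        by (rule ex_rep)
      then obtain k where k: "i = ZN_rep N (q ^ k * a)"
        by (auto simp: cyclotomic_set_def)
      have "\<not> I a \<subseteq> \<Delta>"
        using a i by auto
      then have "F a = 0"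
        using FT[OF a(1)] by (simp add: T_def)
      then show ?thesis
        unfolding k using equivariant_orbit[of F, OF eqv reps_less[OF a(1)]] q by simp
    qed (use supp in simp)
    moreover have "F d ^ q = F d"
    proof -
      obtain a where a: "a \<in> reps" "d \<in> I a"
        using ex_rep[OF d] .
      then obtain k where k: "d = ZN_rep N (q ^ k * a)"
        by (auto simp: cyclotomic_set_def)
      have "F a ^ q = F a"
        using FT[OF a(1)] a q by (auto simp: T_def split: if_splits)
      moreover have "F d = F a ^ (q ^ k)"
        unfolding k by (rule equivariant_orbit[of F, OF eqv reps_less[OF a(1)]])
      ultimately show ?thesis
        using fixed by simp
    qed
    ultimately show "F \<in> ?S"
      using eqv by auto
  qed
  also have "card \<dots> = (\<Prod>a\<in>reps. card (T a))"
    by (rule card_equivariant) (use q in \<open>auto simp: T_def fixed\<close>)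
  also have "\<dots> = (\<Prod>a\<in>reps. q ^ e a)"
    using card_fixed_power[OF card period(1,2)] card_fixed_power[OF card, of 1]
    by (intro prod.cong) (simp_all add: T_def e_def)
  also have "\<dots> = q ^ (\<Sum>a\<in>reps. e a)"
    by (simp add: power_sum)
  finally have cardS: "card ?S = q ^ (\<Sum>a\<in>reps. e a)" .
  define R where "R = {a \<in> reps. I a \<subseteq> \<Delta>}"
  have R: "finite R"
    by (simp add: R_def)
  have sum_e: "(\<Sum>a\<in>reps. e a) = (\<Sum>a\<in>R. if d \<in> I a then 1 else card (I a))"
    unfolding R_def e_def by (rule sum.inter_filter[symmetric]) simp
  have "{z. z < N \<and> I z \<subseteq> \<Delta>} \<union> {z. z < N \<and> \<not> I z \<subseteq> \<Delta>} = {..<N}"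
    by auto
  then have split: "(\<Sum>a\<in>R. card (I a)) + card {z. z < N \<and> \<not> I z \<subseteq> \<Delta>} = N"
    unfolding R_def sum_card_reps[of "\<lambda>A. A \<subseteq> \<Delta>"]
    by (subst card_Un_disjoint[symmetric]) auto
  obtain a where a: "a \<in> reps" "d \<in> I a"
    using ex_rep[OF d] .
  then have Ia: "I a = I d"
    using cyclotomic_set_eqI reps_less by metis
  \<comment> \<open>If the set of \<open>d\<close> lies in \<Delta>, it contributes 1 instead of
    \<open>card (I d)\<close> to the first sum, and the added \<open>card (I d)\<close> repairs this
    up to 1. Otherwise no set indexed by \<open>R\<close> contains \<open>d\<close>, so the two sums
    agree.\<close>
  have "(\<Sum>b\<in>reps. e b) + (if I d \<subseteq> \<Delta> then card (I d) else 1) = (\<Sum>b\<in>R. card (I b)) + 1"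
  proof (cases "I d \<subseteq> \<Delta>")
    case True
    then have "a \<in> R"
      using a Ia by (simp add: R_def)
    moreover have "(\<Sum>b\<in>R - {a}. if d \<in> I b then 1 else card (I b)) = (\<Sum>b\<in>R - {a}. card (I b))"
      using a rep_unique by (intro sum.cong) (auto simp: R_def)
    ultimately show ?thesis
      using True a R by (simp add: sum_e sum.remove[of R a] Ia)
  next
    case False
    have "d \<notin> I b" if "b \<in> R" for b
      using False Ia a rep_unique that by (metis (mono_tags, lifting) R_def mem_Collect_eq)
    then have "(\<Sum>b\<in>R. if d \<in> I b then 1 else card (I b)) = (\<Sum>b\<in>R. card (I b))"
      by (intro sum.cong) auto
    then show ?thesis
      using False by (simp add: sum_e)
  qed
  then have "(\<Sum>b\<in>reps. e b) + (card {z. z < N \<and> \<not> I z \<subseteq> \<Delta>} +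
      (if I d \<subseteq> \<Delta> then card (I d) else 1)) = N + 1"
    using split by linarith
  then show ?thesis
    unfolding cardS power_add[symmetric] by (rule arg_cong)
qed

end

section \<open>The subfield subcode\<close>

lemma card_X_set:
  "card (X_set N :: ('a::{field,finite} \<times> 'a) set) = card (Y_set N :: 'a set) + 1"
proof -
  have "X_set N = insert (0, 1) (Pair (1 :: 'a) ` Y_set N)"
    by (auto simp: X_set_def)
  moreover have "(0, 1) \<notin> Pair (1 :: 'a) ` (Y_set N :: 'a set)"
    by auto
  ultimately show ?thesis
    by (simp add: card_image inj_on_def)
qed

text \<open>Both sums are values of polynomials of degree below \<open>N\<close>, which
  \<open>N\<close> points determine; this permits comparing coefficients of functions on
  \<open>Y_set N\<close>.\<close>

lemma interpolation_unique:
  fixes A B :: "nat \<Rightarrow> 'a::idom"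
  assumes "card Y \<ge> N" and "\<And>z. z \<in> Y \<Longrightarrow> (\<Sum>i<N. A i * z ^ i) = (\<Sum>i<N. B i * z ^ i)" and "i < N"
  shows "A i = B i"
proof -
  define P where "P A = (\<Sum>i<N. monom (A i) i)" for A :: "nat \<Rightarrow> 'a"
  have "degree (P A) < N" for A
    unfolding P_def using assms(3)
    by (intro le_less_trans[OF degree_sum_le[of _ _ "N - 1"]])
       (auto intro!: order.trans[OF degree_monom_le])
  moreover have "poly (P A) z = (\<Sum>i<N. A i * z ^ i)" for A z
    by (simp add: P_def poly_sum poly_monom)
  ultimately have "P A = P B"
    using assms(1,2) by (intro poly_eqI_degree[of Y]) (auto intro: less_le_trans)
  moreover have "coeff (P A) i = A i" for A
    using assms(3) by (simp add: P_def coeff_sum)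
  ultimately show ?thesis
    by metis
qed

text \<open>On \<open>Y_set N\<close>, the \<open>q\<close>-th power of the sum raises each
  coefficient to the \<open>q\<close>-th power and moves its exponent from \<open>i\<close> to
  \<open>ZN_rep N (q * i)\<close>. Uniqueness of the coefficients then gives the
  equivalence.\<close>

lemma (in cyclotomic) values_fixed_iff_equivariant:
  fixes F :: "nat \<Rightarrow> 'a::field"
  assumes frob: "\<And>f A. (\<Sum>i\<in>A. f i :: 'a) ^ q = (\<Sum>i\<in>(A :: nat set). f i ^ q)"
    and Y: "card (Y_set N :: 'a set) = N"
  shows "(\<forall>z\<in>Y_set N. (\<Sum>i<N. F i * z ^ i) ^ q = (\<Sum>i<N. F i * z ^ i)) \<longleftrightarrow>
    (\<forall>i<N. F (ZN_rep N (q * i)) = F i ^ q)"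
proof -
  \<comment> \<open>\<open>\<tau>\<close> is multiplication by \<open>q\<close> on Z_N, and
    multiplication by \<open>q ^ (s - 1)\<close> gives its inverse \<open>\<tau>'\<close>, needed to
    reorder the sum by exponents.\<close>
  define \<tau> where "\<tau> i = ZN_rep N (q * i)" for i
  define \<tau>' where "\<tau>' i = ZN_rep N (q ^ (s - 1) * i)" for i
  have qs: "q ^ (s - 1) * q = q ^ s" "q * q ^ (s - 1) = q ^ s"
    using s by (simp_all flip: power_Suc power_Suc2)
  have inv: "\<tau>' (\<tau> i) = i" "\<tau> (\<tau>' i) = i" if "i < N" for i
    using that ZN_rep_power_s[of 1 i]
    by (simp_all add: \<tau>_def \<tau>'_def ZN_rep_eq_self qs mult.assoc[symmetric] del: One_nat_def)
  have less: "\<tau> i < N" "\<tau>' i < N" for i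
    using N by (simp_all add: \<tau>_def \<tau>'_def ZN_rep_less)
  have power: "(\<Sum>i<N. F i * z ^ i) ^ q = (\<Sum>i<N. F (\<tau>' i) ^ q * z ^ i)" if "z \<in> Y_set N" for z
  proof -
    have "(\<Sum>i<N. F i * z ^ i) ^ q = (\<Sum>i<N. F i ^ q * z ^ \<tau> i)"
      using that N unfolding frob
      by (simp add: Y_set_def \<tau>_def power_ZN_rep power_mult_distrib mult.commute[of q] power_mult)
    also have "\<dots> = (\<Sum>i<N. F (\<tau>' i) ^ q * z ^ i)"
      by (rule sum.reindex_bij_witness[of _ \<tau>' \<tau>]) (use inv less in auto)
    finally show ?thesis .
  qed
  have "(\<forall>z\<in>Y_set N. (\<Sum>i<N. F i * z ^ i) ^ q = (\<Sum>i<N. F i * z ^ i)) \<longleftrightarrow>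
      (\<forall>i<N. F (\<tau>' i) ^ q = F i)"
  proof
    assume "\<forall>z\<in>Y_set N. (\<Sum>i<N. F i * z ^ i) ^ q = (\<Sum>i<N. F i * z ^ i)"
    then show "\<forall>i<N. F (\<tau>' i) ^ q = F i"
      using interpolation_unique[of N "Y_set N :: 'a set" "\<lambda>i. F (\<tau>' i) ^ q" F] power Y by simp
  qed (simp add: power)
  also have "\<dots> \<longleftrightarrow> (\<forall>i<N. F (\<tau> i) = F i ^ q)"
    using inv less by metis
  finally show ?thesis
    by (simp add: \<tau>_def)
qed

text \<open>Coefficients are normalised to vanish outside \<Delta>, so that a word can determine its
  coefficient function uniquely.\<close>

lemma PRS_eq:
  assumes "finite \<Delta>"
  shows "PRS pt \<Delta> = {\<Sum>i\<in>\<Delta>. F i *s ev pt (monomial2 (Max \<Delta> - i) i) | F. \<forall>i. i \<notin> \<Delta> \<longrightarrow> F i = 0}"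
    (is "_ = ?V")
proof
  let ?e = "\<lambda>i. ev pt (monomial2 (Max \<Delta> - i) i)"
  show "PRS pt \<Delta> \<subseteq> ?V"
    unfolding PRS_def
  proof (rule vec.span_minimal)
    show "?e ` \<Delta> \<subseteq> ?V"
    proof clarify
      fix i assume "i \<in> \<Delta>"
      then have "?e i = (\<Sum>j\<in>\<Delta>. (if j = i then 1 else 0) *s ?e j)"
        using assms by (simp add: if_distrib[of "\<lambda>c. c *s _"] cong: if_cong)
      then show "\<exists>F. ?e i = (\<Sum>j\<in>\<Delta>. F j *s ?e j) \<and> (\<forall>j. j \<notin> \<Delta> \<longrightarrow> F j = 0)"
        using \<open>i \<in> \<Delta>\<close> by (intro exI[of _ "\<lambda>j. if j = i then 1 else 0"]) auto
    qed
    show "vec.subspace ?V"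
      unfolding vec.subspace_def
    proof (intro conjI ballI allI)
      show "0 \<in> ?V"
        by (auto intro!: exI[of _ "\<lambda>_. 0"])
    next
      fix x y assume "x \<in> ?V" "y \<in> ?V"
      then obtain F G where "x = (\<Sum>i\<in>\<Delta>. F i *s ?e i)" "\<forall>i. i \<notin> \<Delta> \<longrightarrow> F i = 0"
        "y = (\<Sum>i\<in>\<Delta>. G i *s ?e i)" "\<forall>i. i \<notin> \<Delta> \<longrightarrow> G i = 0"
        by blast
      then show "x + y \<in> ?V"
        by (auto intro!: exI[of _ "\<lambda>i. F i + G i"] simp: sum.distrib vec.scale_left_distrib)
    next
      fix c x assume "x \<in> ?V"
      then obtain F where "x = (\<Sum>i\<in>\<Delta>. F i *s ?e i)" "\<forall>i. i \<notin> \<Delta> \<longrightarrow> F i = 0"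
        by blast
      then show "c *s x \<in> ?V"
        by (auto intro!: exI[of _ "\<lambda>i. c * F i"] simp: vec.scale_sum_right)
    qed
  qed
  show "?V \<subseteq> PRS pt \<Delta>"
    unfolding PRS_def by clarify (intro vec.span_sum vec.span_scale vec.span_base imageI)
qed

section \<open>Words with entries in the subfield\<close>

lemma field_embeddingD:
  assumes "field_embedding \<iota>"
  shows "\<iota> 0 = 0" "\<iota> 1 = 1" "\<iota> (x + y) = \<iota> x + \<iota> y" "\<iota> (x * y) = \<iota> x * \<iota> y"
    "\<iota> (x ^ n) = \<iota> x ^ n" "inj \<iota>"
proof -
  show hom: "\<iota> 1 = 1" "\<iota> (x + y) = \<iota> x + \<iota> y" "\<iota> (x * y) = \<iota> x * \<iota> y" for x y
    using assms by (auto simp: field_embedding_def)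
  show zero: "\<iota> 0 = 0"
    using hom(2)[of 0 0] by (metis add_0_right add_cancel_right_right)
  show "\<iota> (x ^ n) = \<iota> x ^ n"
    by (induction n) (simp_all add: hom)
  show "inj \<iota>"
  proof (rule injI, rule ccontr)
    fix x y assume "\<iota> x = \<iota> y" "x \<noteq> y"
    then have "\<iota> (x - y) = 0"
      using hom(2)[of "x - y" y] by simp
    then show False
      using hom(3)[of "x - y" "inverse (x - y)"] hom(1) \<open>x \<noteq> y\<close> by simp
  qed
qed

lemma subspace_subfield_subcode:
  assumes \<iota>: "field_embedding \<iota>" and C: "vec.subspace C"
  shows "vec.subspace (subfield_subcode \<iota> C)"
  unfolding vec.subspace_def subfield_subcode_def
proof (intro conjI ballI allI; clarify)
  note hom = field_embeddingD[OF \<iota>]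
  show "(\<chi> j. \<iota> (0 $ j)) \<in> C"
    using vec.subspace_0[OF C] by (simp add: hom zero_vec_def)
  fix x y c assume x: "(\<chi> j. \<iota> (x $ j)) \<in> C"
  have "(\<chi> j. \<iota> ((c *s x) $ j)) = \<iota> c *s (\<chi> j. \<iota> (x $ j))"
    by (simp add: hom vec_eq_iff)
  then show "(\<chi> j. \<iota> ((c *s x) $ j)) \<in> C"
    using vec.subspace_scale[OF C x] by simp
  assume y: "(\<chi> j. \<iota> (y $ j)) \<in> C"
  have "(\<chi> j. \<iota> ((x + y) $ j)) = (\<chi> j. \<iota> (x $ j)) + (\<chi> j. \<iota> (y $ j))"
    by (simp add: hom vec_eq_iff)
  then show "(\<chi> j. \<iota> ((x + y) $ j)) \<in> C"
    using vec.subspace_add[OF C x y] by simp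
qed

lemma range_field_embedding:
  fixes \<iota> :: "'k::{field,finite} \<Rightarrow> 'a::{field,finite}"
  assumes "field_embedding \<iota>" and "card {x :: 'a. x ^ CARD('k) = x} = CARD('k)"
  shows "range \<iota> = {x. x ^ CARD('k) = x}"
proof (rule card_subset_eq)
  show "range \<iota> \<subseteq> {x. x ^ CARD('k) = x}"
    by (auto simp: finite_field_power_card simp flip: field_embeddingD(5)[OF assms(1)])
  show "card (range \<iota>) = card {x :: 'a. x ^ CARD('k) = x}"
    using assms field_embeddingD(6)[OF assms(1)] by (simp add: card_image)
qed simp

text \<open>Subfield words are replaced by the words of \<open>C\<close> whose entries are fixed by
  Frobenius, so that the count takes place inside the larger field.\<close>

lemma card_subfield_subcode:
  fixes \<iota> :: "'k::{field,finite} \<Rightarrow> 'a::{field,finite}"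
  assumes "field_embedding \<iota>" and "card {x :: 'a. x ^ CARD('k) = x} = CARD('k)"
  shows "card (subfield_subcode \<iota> C) = card {w \<in> C. \<forall>j. (w $ j) ^ CARD('k) = w $ j}"
proof (rule bij_betw_same_card)
  note range = range_field_embedding[OF assms] and inj = field_embeddingD(6)[OF assms(1)]
  show "bij_betw (\<lambda>c. \<chi> j. \<iota> (c $ j)) (subfield_subcode \<iota> C)
      {w \<in> C. \<forall>j. (w $ j) ^ CARD('k) = w $ j}"
  proof (rule bij_betw_byWitness[where f' = "\<lambda>w. \<chi> j. inv \<iota> (w $ j)"])
    show "(\<lambda>c. \<chi> j. \<iota> (c $ j)) ` subfield_subcode \<iota> C
        \<subseteq> {w \<in> C. \<forall>j. (w $ j) ^ CARD('k) = w $ j}"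
      using range by (auto simp: subfield_subcode_def)
    have "\<iota> (inv \<iota> x) = x" if "x ^ CARD('k) = x" for x
      using that range by (intro f_inv_into_f) auto
    then show "\<forall>w\<in>{w \<in> C. \<forall>j. (w $ j) ^ CARD('k) = w $ j}. (\<chi> j. \<iota> ((\<chi> j. inv \<iota> (w $ j)) $ j)) = w"
      "(\<lambda>w. \<chi> j. inv \<iota> (w $ j)) ` {w \<in> C. \<forall>j. (w $ j) ^ CARD('k) = w $ j} \<subseteq> subfield_subcode \<iota> C"
      by (auto simp: subfield_subcode_def)
  qed (simp add: inv_f_f[OF inj])
qed

text \<open>The coordinates at the points \<open>(1, z)\<close> are polynomial values, all fixed
  exactly when \<open>F\<close> is equivariant; the coordinate at \<open>(0, 1)\<close> is
  \<open>F d\<close> and gives the last condition. The correspondence between words and coefficient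
  functions is injective because the values at the \<open>N\<close> affine points determine
  \<open>F\<close>.\<close>

lemma (in cyclotomic) card_fixed_PRS:
  fixes pt :: "'n::finite \<Rightarrow> 'a::field \<times> 'a"
  assumes frob: "\<And>f A. (\<Sum>i\<in>A. f i :: 'a) ^ q = (\<Sum>i\<in>(A :: nat set). f i ^ q)"
    and Y: "card (Y_set N :: 'a set) = N"
    and \<Delta>: "\<Delta> \<subseteq> {..<N}" "\<Delta> \<noteq> {}" and d: "d = Max \<Delta>" and pt: "range pt = X_set N"
  shows "card {w \<in> PRS pt \<Delta>. \<forall>j. (w $ j) ^ q = w $ j} =
    card {F :: nat \<Rightarrow> 'a. (\<forall>i. i \<notin> \<Delta> \<longrightarrow> F i = 0) \<and>
      (\<forall>i<N. F (ZN_rep N (q * i)) = F i ^ q) \<and> F d ^ q = F d}"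
    (is "card ?W = card ?S")
proof -
  have fin: "finite \<Delta>"
    using \<Delta> finite_subset by blast
  define w where "w F = (\<Sum>i\<in>\<Delta>. F i *s ev pt (monomial2 (Max \<Delta> - i) i))" for F
  have w: "w F $ j = (\<Sum>i\<in>\<Delta>. F i * (fst (pt j) ^ (d - i) * snd (pt j) ^ i))" for F j
    using eval2_monomial2[of _ _ "fst (pt j)" "snd (pt j)"] by (simp add: w_def ev_def d)
  have affine_pt: "w F $ j = (\<Sum>i<N. F i * z ^ i)"
    if "pt j = (1, z)" "\<forall>i. i \<notin> \<Delta> \<longrightarrow> F i = 0" for F j z
    unfolding w using that \<Delta> by (intro sum.mono_neutral_cong_left) auto
  have pt_at_infinity: "w F $ j = F d" if "pt j = (0, 1)" for F j
  proof -
    have "d \<in> \<Delta>"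
      using \<Delta> fin d Max_in by blast
    \<comment> \<open>the terms \<open>i < d\<close> vanish because of the factor \<open>0 ^ (d - i)\<close>\<close>
    have "i < d" if "i \<in> \<Delta> - {d}" for i
      using that Max_ge[OF fin] by (auto simp: d order_less_le)
    then have "w F $ j = (\<Sum>i\<in>{d}. F i * (fst (pt j) ^ (d - i) * snd (pt j) ^ i))"
      unfolding w using \<open>d \<in> \<Delta>\<close> fin that
      by (intro sum.mono_neutral_right) (auto simp: zero_power)
    then show ?thesis
      using that by simp
  qed
  have surj_pt: "\<exists>j. pt j = (1, z)" if "z \<in> Y_set N" for z
  proof -
    have "(1, z) \<in> range pt"
      unfolding pt using that by (simp add: X_set_def)
    then show ?thesis
      by (metis imageE)
  qed
  have "(0, 1) \<in> range pt"
    unfolding pt by (simp add: X_set_def)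
  then have infty: "\<exists>j. pt j = (0, 1)"
    by (metis imageE)
  have fixed: "(\<forall>j. (w F $ j) ^ q = w F $ j) \<longleftrightarrow>
      (\<forall>i<N. F (ZN_rep N (q * i)) = F i ^ q) \<and> F d ^ q = F d"
    if F: "\<forall>i. i \<notin> \<Delta> \<longrightarrow> F i = 0" for F
  proof -
    have "(\<forall>j. (w F $ j) ^ q = w F $ j) \<longleftrightarrow>
        (\<forall>z\<in>Y_set N. (\<Sum>i<N. F i * z ^ i) ^ q = (\<Sum>i<N. F i * z ^ i)) \<and> F d ^ q = F d"
    proof (intro iffI conjI ballI allI)
      fix z :: 'a assume *: "\<forall>j. (w F $ j) ^ q = w F $ j"
      show "F d ^ q = F d"
        using infty pt_at_infinity * by metis
      assume "z \<in> Y_set N"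
      then show "(\<Sum>i<N. F i * z ^ i) ^ q = (\<Sum>i<N. F i * z ^ i)"
        using surj_pt affine_pt[OF _ F] * by metis
    next
      fix j
      assume *: "(\<forall>z\<in>Y_set N. (\<Sum>i<N. F i * z ^ i) ^ q = (\<Sum>i<N. F i * z ^ i)) \<and> F d ^ q = F d"
      have "pt j \<in> X_set N"
        using pt by auto
      then show "(w F $ j) ^ q = w F $ j"
        using * affine_pt[of j _ F] pt_at_infinity[of j F] F by (auto simp: X_set_def)
    qed
    then show ?thesis
      unfolding values_fixed_iff_equivariant[OF frob Y] .
  qed
  have "inj_on w {F. \<forall>i. i \<notin> \<Delta> \<longrightarrow> F i = 0}"
  proof (rule inj_onI, rule ext)
    fix F G i
    assume F: "F \<in> {F. \<forall>i. i \<notin> \<Delta> \<longrightarrow> F i = 0}" and G: "G \<in> {F. \<forall>i. i \<notin> \<Delta> \<longrightarrow> F i = 0}"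
      and eq: "w F = w G"
    have "(\<Sum>i<N. F i * z ^ i) = (\<Sum>i<N. G i * z ^ i)" if "z \<in> Y_set N" for z
    proof -
      obtain j where "pt j = (1, z)"
        using surj_pt \<open>z \<in> Y_set N\<close> by blast
      then show ?thesis
        using affine_pt[of j z F] affine_pt[of j z G] F G eq by simp
    qed
    then have "F i = G i" if "i < N"
      using interpolation_unique[of N "Y_set N" F G i] Y that by simp
    then show "F i = G i"
      using F G \<Delta> by (cases "i \<in> \<Delta>") auto
  qed
  then have "inj_on w ?S"
    by (rule inj_on_subset) auto
  moreover have "?W = w ` ?S"
    unfolding PRS_eq[OF fin] using fixed by (auto simp flip: w_def)
  ultimately show ?thesis
    by (simp add: card_image)
qed

theorem corollary4p16:
  fixes \<iota> :: "'k::{field,finite} \<Rightarrow> 'a::{field,finite}"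
    and pt :: "'n::finite \<Rightarrow> 'a \<times> 'a"
    and p m q s N d :: nat
    and \<Delta> :: "nat set"
  assumes "prime p" and "m \<ge> 1" and "q = p ^ m" and "s \<ge> 1"
    and "CARD('k) = q" and "CARD('a) = q ^ s" and "field_embedding \<iota>"
    and "N > 1" and "(N - 1) dvd (q ^ s - 1)" and "p dvd N"
    and "\<Delta> \<subseteq> {0..N - 1}" and "0 \<in> \<Delta>" and "d = Max \<Delta>"
    and "bij_betw pt UNIV (X_set N)"
  shows "vec.dim (dual_code (subfield_subcode \<iota> (PRS pt \<Delta>))) =
    (if cyclotomic_set N q d \<subseteq> \<Delta>
     then (\<Sum>a | a \<in> cyclotomic_reps N q \<and> cyclotomic_set N q a \<inter> dual_exponents N \<Delta> \<noteq> {}.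
             card (cyclotomic_set N q a)) + card (cyclotomic_set N q d)
     else (\<Sum>a | a \<in> cyclotomic_reps N q \<and> cyclotomic_set N q a \<inter> dual_exponents N \<Delta> \<noteq> {}.
             card (cyclotomic_set N q a)) + 1)"
proof -
  have q: "q > 1"
    using one_less_power[OF prime_gt_1_nat[OF assms(1)], of m] assms(2,3) by simp
  interpret cyclotomic N q s
    using assms q by unfold_locales auto
  have \<Delta>: "\<Delta> \<subseteq> {..<N}" "\<Delta> \<noteq> {}"
    using assms by auto
  then have d: "d \<in> \<Delta>"
    using assms finite_subset Max_in by blast
  have Y: "card (Y_set N :: 'a set) = N"
    unfolding Y_set_def using assms by (intro card_power_eq_self) auto
  have fixed: "card {x :: 'a. x ^ CARD('k) = x} = CARD('k)"
    using card_fixed_power[where 'a = 'a, of 1] assms by simp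
  have "CARD('a) = p ^ (m * s)"
    using assms by (simp add: power_mult)
  then have "CHAR('a) = p"
    using assms CHAR_eq_if_CARD_prime_power by blast
  then have frob: "(\<Sum>i\<in>A. f i :: 'a) ^ q = (\<Sum>i\<in>A. f i ^ q)" for f and A :: "nat set"
    using assms by (intro freshmans_dream_sum') auto
  define C where "C = subfield_subcode \<iota> (PRS pt \<Delta>)"
  \<comment> \<open>\<open>u\<close> is the claimed dimension before reflection: it counts exponents
    whose cyclotomic set leaves \<Delta> instead of those whose set meets the dual
    exponents.\<close>
  define u where "u = card {z. z < N \<and> \<not> I z \<subseteq> \<Delta>} + (if I d \<subseteq> \<Delta> then card (I d) else 1)"
  have C: "vec.subspace C"
    unfolding C_def PRS_def by (intro subspace_subfield_subcode assms vec.subspace_span)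
  have "card C = card {w \<in> PRS pt \<Delta>. \<forall>j. (w $ j) ^ q = w $ j}"
    using card_subfield_subcode[OF assms(7) fixed] assms by (simp add: C_def)
  also have "\<dots> = card {F :: nat \<Rightarrow> 'a. (\<forall>i. i \<notin> \<Delta> \<longrightarrow> F i = 0) \<and>
      (\<forall>i<N. F (ZN_rep N (q * i)) = F i ^ q) \<and> F d ^ q = F d}"
    by (rule card_fixed_PRS) (use frob Y \<Delta> assms in \<open>auto simp: bij_betw_def\<close>)
  finally have "card C * q ^ u = q ^ (N + 1)"
    using card_equivariant_supported[where 'a = 'a, OF _ \<Delta>(1) d] assms by (simp add: u_def)
  moreover have "CARD('n) = N + 1"
    using bij_betw_same_card[OF assms(14)] by (simp add: card_X_set Y)
  then have "card (dual_code C) * card C = q ^ (N + 1)"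
    using card_dual_code[OF C] assms by simp
  moreover have "card C > 0"
    using vec.subspace_0[OF C] by (auto simp: card_gt_0_iff)
  \<comment> \<open>Both sides have product \<open>q ^ (N + 1)\<close> with the positive number
    \<open>card C\<close>.\<close>
  ultimately have "card (dual_code C) = q ^ u"
    by (metis mult.commute mult_cancel1 less_irrefl)
  then have "vec.dim (dual_code C) = u"
    using card_vec_subspace[OF subspace_dual_code, of C] q assms by simp
  then show ?thesis
    using sum_card_reps[of "\<lambda>A. A \<inter> dual_exponents N \<Delta> \<noteq> {}"] card_meeting_dual_exponents[OF \<Delta>(1)]
    by (simp add: C_def u_def)
qed

end
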